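(* Let $G$ be an active graph. 1. If $\deg(G)=1$, then $G\approx P_4$. 2. If $\deg(G)=2$ and $G$ is decomposable, then $G\approx P_4^2$. 3. If $\deg(G)=2$ and $G$ is indecomposable, then $G$ is isomorphic to one of the graphs $D_{2,1}$, $\overline{D_{2,1}}$, $C_4$, $2K_2$.
   Context: Graphs are finite and simple, with nonempty vertex set; $\approx$ is isomorphism and $\overline{G}$ is the complement of $G$. A 2-switch on $G$: given four distinct vertices $a,b,x,y$ with $ab,xy\in E(G)$ and $ax,by\notin E(G)$, delete the edges $ab,xy$ and add the edges $ax,by$ (two 2-switches are equal iff they delete the same two edges and add the same two edges). The 2-switch-degree $\deg(G)$ is the number of distinct 2-switches that can be performed on $G$. A vertex is active in $G$ if it is one of the four vertices involved in some 2-switch on $G$; $G$ is active if all its vertices are active. A split graph is a graph whose vertex set can be partitioned into a clique $K$ and an independent set $I$ (either possibly empty); when such a bipartition $(K,I)$ is fixed one writes $(S,K,I)$. An active split graph has a unique bipartition. If $(S,K,I)$ is split and $G$ is a graph vertex-disjoint from $S$, the Tyshkevich composition $(S,K,I)\circ G$ has vertex set $V(S)\cup V(G)$ and edge set $E(S)\cup E(G)\cup\{xy: x\in K,\ y\in V(G)\}$. A graph $G$ is decomposable if $G=S\circ H$ for some $S,H$ with $|S|,|H|\ge 1$, and indecomposable otherwise. $P_4^2=P_4\circ P_4$ is the composition of two disjoint copies of the path $P_4$, whose bipartition is ($K$ = the two inner vertices, $I$ = the two end vertices). $D_{2,1}$ is the split graph with clique $\{1,2,3\}$ and independent set $\{a,b\}$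 with $N_a=\{1\}$, $N_b=\{2,3\}$. *)

theory Defs
  imports Main
begin

record 'a sgraph =
  verts :: "'a set"
  edges :: "'a set set"

text \<open>Finite simple graphs with nonempty vertex set; the edge \<open>uv\<close> is the set \<open>{u, v}\<close>.\<close>

definition simple_graph :: "'a sgraph \<Rightarrow> bool" where
  "simple_graph G \<longleftrightarrow> finite (verts G) \<and> verts G \<noteq> {} \<and>
     (\<forall>e\<in>edges G. \<exists>u\<in>verts G. \<exists>v\<in>verts G. u \<noteq> v \<and> e = {u, v})"

definition isomorphic :: "'a sgraph \<Rightarrow> 'b sgraph \<Rightarrow> bool" where
  "isomorphic G H \<longleftrightarrow> (\<exists>f. bij_betw f (verts G) (verts H) \<and>
     (\<forall>u\<in>verts G. \<forall>v\<in>verts G. {u, v} \<in> edges G \<longleftrightarrow> {f u, f v} \<in> edges H))"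

definition complement :: "'a sgraph \<Rightarrow> 'a sgraph" where
  "complement G = \<lparr>verts = verts G,
     edges = {{u, v} | u v. u \<in> verts G \<and> v \<in> verts G \<and> u \<noteq> v \<and> {u, v} \<notin> edges G}\<rparr>"

text \<open>\<open>can_switch G a b x y\<close>: deleting \<open>ab\<close>, \<open>xy\<close> and adding \<open>ax\<close>, \<open>by\<close> is a 2-switch on \<open>G\<close>.\<close>

definition can_switch :: "'a sgraph \<Rightarrow> 'a \<Rightarrow> 'a \<Rightarrow> 'a \<Rightarrow> 'a \<Rightarrow> bool" where
  "can_switch G a b x y \<longleftrightarrow> distinct [a, b, x, y] \<and>
     {a, b} \<in> edges G \<and> {x, y} \<in> edges G \<and> {a, x} \<notin> edges G \<and> {b, y} \<notin> edges G"

text \<open>A 2-switch is identified with the pair (set of deleted edges, set of added edges), so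
  that different labellings \<open>a, b, x, y\<close> of the same switch are counted once.\<close>

definition two_switches :: "'a sgraph \<Rightarrow> ('a set set \<times> 'a set set) set" where
  "two_switches G =
     {({{a, b}, {x, y}}, {{a, x}, {b, y}}) | a b x y. can_switch G a b x y}"

definition switch_degree :: "'a sgraph \<Rightarrow> nat" where
  "switch_degree G = card (two_switches G)"

definition active_vertex :: "'a sgraph \<Rightarrow> 'a \<Rightarrow> bool" where
  "active_vertex G v \<longleftrightarrow> (\<exists>a b x y. can_switch G a b x y \<and> v \<in> {a, b, x, y})"

definition active :: "'a sgraph \<Rightarrow> bool" where
  "active G \<longleftrightarrow> (\<forall>v\<in>verts G. active_vertex G v)"

definition split_graph :: "'a sgraph \<Rightarrow> 'a set \<Rightarrow> 'a set \<Rightarrow> bool" where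
  "split_graph S K I \<longleftrightarrow> simple_graph S \<and> K \<union> I = verts S \<and> K \<inter> I = {} \<and>
     (\<forall>u\<in>K. \<forall>v\<in>K. u \<noteq> v \<longrightarrow> {u, v} \<in> edges S) \<and>
     (\<forall>u\<in>I. \<forall>v\<in>I. {u, v} \<notin> edges S)"

text \<open>The composition of \<open>(S, K, I)\<close> with \<open>G\<close>; the independent part \<open>I\<close> does not occur in the
  formula. Meant for \<open>S\<close> and \<open>G\<close> with disjoint vertex sets.\<close>

definition tyshkevich :: "'a sgraph \<Rightarrow> 'a set \<Rightarrow> 'a sgraph \<Rightarrow> 'a sgraph" where
  "tyshkevich S K G = \<lparr>verts = verts S \<union> verts G,
     edges = edges S \<union> edges G \<union> {{x, y} | x y. x \<in> K \<and> y \<in> verts G}\<rparr>"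

text \<open>Both factors are nonempty because \<open>simple_graph\<close> requires a nonempty vertex set.\<close>

definition decomposable :: "'a sgraph \<Rightarrow> bool" where
  "decomposable G \<longleftrightarrow> (\<exists>S K I H. split_graph S K I \<and> simple_graph H \<and>
     verts S \<inter> verts H = {} \<and> G = tyshkevich S K H)"

definition indecomposable :: "'a sgraph \<Rightarrow> bool" where
  "indecomposable G \<longleftrightarrow> \<not> decomposable G"

definition path4 :: "'a \<Rightarrow> 'a \<Rightarrow> 'a \<Rightarrow> 'a \<Rightarrow> 'a sgraph" where
  "path4 a b c d = \<lparr>verts = {a, b, c, d}, edges = {{a, b}, {b, c}, {c, d}}\<rparr>"

definition P4 :: "nat sgraph" where
  "P4 = path4 1 2 3 4"

definition P4_squared :: "nat sgraph" where
  "P4_squared = tyshkevich (path4 1 2 3 4) {2, 3} (path4 5 6 7 8)"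

definition C4 :: "nat sgraph" where
  "C4 = \<lparr>verts = {1, 2, 3, 4}, edges = {{1, 2}, {2, 3}, {3, 4}, {4, 1}}\<rparr>"

definition two_K2 :: "nat sgraph" where
  "two_K2 = \<lparr>verts = {1, 2, 3, 4}, edges = {{1, 2}, {3, 4}}\<rparr>"

text \<open>Clique \<open>{1, 2, 3}\<close>; the independent vertices \<open>a\<close>, \<open>b\<close> are encoded as \<open>4\<close>, \<open>5\<close>.\<close>

definition D21 :: "nat sgraph" where
  "D21 = \<lparr>verts = {1, 2, 3, 4, 5},
     edges = {{1, 2}, {1, 3}, {2, 3}, {4, 1}, {5, 2}, {5, 3}}\<rparr>"

end

theory Submission imports Defs begin

text \<open>
  A 2-switch is the same thing as an alternating 4-cycle \<open>a b y x\<close>: two disjoint edges \<open>ab\<close>,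
  \<open>xy\<close> and two disjoint non-edges \<open>ax\<close>, \<open>by\<close> on the same four vertices.  The remaining two pairs
  \<open>ay\<close>, \<open>bx\<close> decide which graph these vertices induce: a path \<open>P\<^sub>4\<close> if exactly one of the
  two is an edge, and \<open>C\<^sub>4\<close> or \<open>2K\<^sub>2\<close> otherwise.  A \<open>P\<^sub>4\<close> carries a single switch
  (\<open>induced_path_switch_unique\<close>), while \<open>C\<^sub>4\<close> and \<open>2K\<^sub>2\<close> carry at least two
  (\<open>path_or_two_on_support\<close>).  In an active graph the vertex sets of the switches cover
  everything, so degree 1 forces \<open>P\<^sub>4\<close>, and degree 2 leaves two possibilities
  (\<open>switch_degree_two_cases\<close>): the graph has four vertices and is \<open>C\<^sub>4\<close> or \<open>2K\<^sub>2\<close>, or its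
  vertex set is the union of two different sets \<open>P\<close>, \<open>Q\<close>, each inducing a \<open>P\<^sub>4\<close>, and
  every switch lives on \<open>P\<close> or on \<open>Q\<close>.

  If the graph is a composition, no alternating 4-cycle crosses between the two factors
  (\<open>can_switch_tyshkevich\<close>), and both factors contain vertices of switches; hence \<open>P\<close> and
  \<open>Q\<close> are exactly the two factors.  In the split factor the clique has to consist of the two inner
  vertices of the path, which gives \<open>P\<^sub>4 \<circ> P\<^sub>4\<close>.

  If the graph is indecomposable and has two paths, look at a vertex \<open>v\<close> of \<open>Q\<close> outside \<open>P\<close>.
  Since \<open>Q\<close> is the only vertex set of a switch containing \<open>v\<close>, its neighbourhood in the path
  \<open>P\<close> is very restricted (\<open>induced_path_extension\<close>).  Either \<open>v\<close> is a twin of a vertex of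
  the path, and then the graph has five vertices and is \<open>D\<^bsub>2,1\<^esub>\<close> or its complement; or \<open>v\<close>
  is level: it sees none, the inner two, or all four vertices of the path.  By symmetry of \<open>P\<close> and
  \<open>Q\<close> it remains to exclude that all these vertices are level.  In that case the reversal of
  the path \<open>P\<close> is an automorphism, it has to preserve \<open>Q\<close>, and as a \<open>P\<^sub>4\<close> has no twins
  this makes \<open>P\<close> and \<open>Q\<close> disjoint (\<open>level_paths_disjoint\<close>).  Finally, two disjoint paths that
  are level to each other form one of the two compositions, because every other adjacency pattern
  between them would create a third switch (\<open>level_paths_decomposable\<close>).
\<close>

section \<open>Adjacency, switches and induced paths\<close>

definition adj :: "'a sgraph \<Rightarrow> 'a \<Rightarrow> 'a \<Rightarrow> bool" where
  "adj G u v \<longleftrightarrow> {u, v} \<in> edges G"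

lemma adj_commute: "adj G u v \<longleftrightarrow> adj G v u"
  by (simp add: adj_def insert_commute)

lemma adj_in_verts:
  assumes "simple_graph G" "adj G u v"
  shows "u \<in> verts G" "v \<in> verts G" "u \<noteq> v"
  using assms unfolding simple_graph_def adj_def by (fastforce simp: doubleton_eq_iff)+

lemma can_switch_iff:
  "can_switch G a b x y \<longleftrightarrow> distinct [a, b, x, y] \<and>
     adj G a b \<and> adj G x y \<and> \<not> adj G a x \<and> \<not> adj G b y"
  by (simp add: can_switch_def adj_def)

lemma adj_complement:
  "adj (complement G) u v \<longleftrightarrow> u \<in> verts G \<and> v \<in> verts G \<and> u \<noteq> v \<and> \<not> adj G u v"
  by (auto simp: adj_def complement_def doubleton_eq_iff insert_commute)

lemma adj_tyshkevich:
  "adj (tyshkevich S K H) u v \<longleftrightarrow>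
     adj S u v \<or> adj H u v \<or> u \<in> K \<and> v \<in> verts H \<or> v \<in> K \<and> u \<in> verts H"
  by (auto simp: adj_def tyshkevich_def doubleton_eq_iff)

lemma can_switch_in_verts:
  assumes "simple_graph G" "can_switch G a b x y"
  shows "{a, b, x, y} \<subseteq> verts G"
  using assms adj_in_verts[OF assms(1)] by (auto simp: can_switch_iff)

definition induced_path :: "'a sgraph \<Rightarrow> 'a \<Rightarrow> 'a \<Rightarrow> 'a \<Rightarrow> 'a \<Rightarrow> bool" where
  "induced_path G a b c d \<longleftrightarrow> distinct [a, b, c, d] \<and>
     adj G a b \<and> adj G b c \<and> adj G c d \<and> \<not> adj G a c \<and> \<not> adj G b d \<and> \<not> adj G a d"

lemma induced_path_can_switch: "induced_path G a b c d \<Longrightarrow> can_switch G a b c d"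
  by (simp add: induced_path_def can_switch_iff)

lemma induced_path_rev: "induced_path G a b c d \<Longrightarrow> induced_path G d c b a"
  by (auto simp: induced_path_def adj_commute)

section \<open>Isomorphisms\<close>

text \<open>
  Isomorphisms between small concrete graphs are given by two lists of vertices in corresponding
  order; \<open>pres\<close> then becomes a finite table of adjacencies.  The map is returned explicitly because
  the composition of isomorphic factors has to know where the clique goes.
\<close>

lemma list_isomorphism:
  assumes xs: "distinct xs" "set xs = verts G" and ys: "distinct ys" "set ys = verts H"
    and len: "length xs = length ys"
    and pres: "\<forall>(x, x')\<in>set (zip xs ys). \<forall>(y, y')\<in>set (zip xs ys). adj G x y \<longleftrightarrow> adj H x' y'"
  obtains f where "map f xs = ys" "bij_betw f (verts G) (verts H)"
    "\<forall>u\<in>verts G. \<forall>v\<in>verts G. adj G u v \<longleftrightarrow> adj H (f u) (f v)"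
proof -
  define f where "f = (\<lambda>x. the (map_of (zip xs ys) x))"
  have f: "f (xs ! i) = ys ! i" if "i < length xs" for i
    using that xs(1) len by (simp add: f_def map_of_zip_nth)
  then have m: "map f xs = ys"
    using len by (simp add: list_eq_iff_nth_eq)
  then have "f ` set xs = set ys" by (metis image_set)
  moreover have "inj_on f (set xs)" using m ys(1) by (metis distinct_map)
  ultimately have "bij_betw f (verts G) (verts H)" using xs ys by (simp add: bij_betw_def)
  moreover have "(u, f u) \<in> set (zip xs ys)" if "u \<in> verts G" for u
    using that f len xs(2) by (metis (no_types, lifting) in_set_conv_nth in_set_zip fst_conv snd_conv)
  then have "\<forall>u\<in>verts G. \<forall>v\<in>verts G. adj G u v \<longleftrightarrow> adj H (f u) (f v)"
    using pres by fastforce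
  ultimately show thesis using m that by blast
qed

lemma isomorphic_if_list:
  assumes "distinct xs" "set xs = verts G" "distinct ys" "set ys = verts H"
    "length xs = length ys"
    "\<forall>(x, x')\<in>set (zip xs ys). \<forall>(y, y')\<in>set (zip xs ys). adj G x y \<longleftrightarrow> adj H x' y'"
  shows "isomorphic G H"
  using list_isomorphism[OF assms] unfolding isomorphic_def adj_def by metis

lemma no_loop: "simple_graph G \<Longrightarrow> \<not> adj G u u"
  using adj_in_verts(3) by fastforce

lemma induced_path_iso_path4:
  assumes "simple_graph G" "induced_path G a b c d" "verts G = {a, b, c, d}"
    and "distinct [i, j, k, l]"
  obtains f where "map f [a, b, c, d] = [i, j, k, l]"
    "bij_betw f (verts G) (verts (path4 i j k l))"
    "\<forall>u\<in>verts G. \<forall>v\<in>verts G. adj G u v \<longleftrightarrow> adj (path4 i j k l) (f u) (f v)"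
proof (rule list_isomorphism[of "[a, b, c, d]" G "[i, j, k, l]" "path4 i j k l"])
  show "\<forall>(x, x')\<in>set (zip [a, b, c, d] [i, j, k, l]).
     \<forall>(y, y')\<in>set (zip [a, b, c, d] [i, j, k, l]). adj G x y \<longleftrightarrow> adj (path4 i j k l) x' y'"
    using assms no_loop[OF assms(1)]
    by (auto simp: induced_path_def path4_def adj_def insert_commute doubleton_eq_iff)
qed (use assms that in \<open>auto simp: induced_path_def path4_def\<close>)

lemma isomorphic_P4:
  assumes "simple_graph G" "induced_path G a b c d" "verts G = {a, b, c, d}"
  shows "isomorphic G P4"
proof -
  have "distinct [1, 2, 3, 4 :: nat]" by simp
  from induced_path_iso_path4[OF assms this] show ?thesis
    unfolding isomorphic_def P4_def adj_def by metis
qed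

lemma adj_C4: "adj C4 u v \<longleftrightarrow> (u, v) \<in> {(1, 2), (2, 1), (2, 3), (3, 2), (3, 4), (4, 3), (4, 1), (1, 4)}"
  by (auto simp: adj_def C4_def doubleton_eq_iff)

lemma adj_two_K2: "adj two_K2 u v \<longleftrightarrow> (u, v) \<in> {(1, 2), (2, 1), (3, 4), (4, 3)}"
  by (auto simp: adj_def two_K2_def doubleton_eq_iff)

lemma adj_D21: "adj D21 u v \<longleftrightarrow> (u, v) \<in> {(1, 2), (2, 1), (1, 3), (3, 1), (2, 3), (3, 2),
    (4, 1), (1, 4), (5, 2), (2, 5), (5, 3), (3, 5)}"
  by (auto simp: adj_def D21_def doubleton_eq_iff)

lemma verts_D21: "verts D21 = {1, 2, 3, 4, 5}"
  by (simp add: D21_def)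

lemma isomorphic_C4:
  assumes "simple_graph G" "verts G = {a, b, x, y}" "can_switch G a b x y" "adj G a y" "adj G b x"
  shows "isomorphic G C4"
proof (rule isomorphic_if_list[of "[a, b, x, y]" G "[1, 2, 3, 4]" "C4"])
  show "\<forall>(u, u')\<in>set (zip [a, b, x, y] [1, 2, 3, 4]).
      \<forall>(w, w')\<in>set (zip [a, b, x, y] [1, 2, 3, 4]). adj G u w \<longleftrightarrow> adj (C4) u' w'"
    using assms(2-) no_loop[OF assms(1)]
    by (simp add: can_switch_iff adj_commute[of G] adj_C4)
next
  show "set [1, 2, 3, 4] = verts (C4)" by (auto simp: C4_def complement_def)
qed (use assms in \<open>auto simp: can_switch_iff\<close>)

lemma isomorphic_two_K2:
  assumes "simple_graph G" "verts G = {a, b, x, y}" "can_switch G a b x y" "\<not> adj G a y" "\<not> adj G b x"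
  shows "isomorphic G two_K2"
proof (rule isomorphic_if_list[of "[a, b, x, y]" G "[1, 2, 3, 4]" "two_K2"])
  show "\<forall>(u, u')\<in>set (zip [a, b, x, y] [1, 2, 3, 4]).
      \<forall>(w, w')\<in>set (zip [a, b, x, y] [1, 2, 3, 4]). adj G u w \<longleftrightarrow> adj (two_K2) u' w'"
    using assms(2-) no_loop[OF assms(1)]
    by (simp add: can_switch_iff adj_commute[of G] adj_two_K2)
next
  show "set [1, 2, 3, 4] = verts (two_K2)" by (auto simp: two_K2_def complement_def)
qed (use assms in \<open>auto simp: can_switch_iff\<close>)

text \<open>
  Adding to a \<open>P\<^sub>4\<close> an adjacent twin of an inner vertex gives \<open>D\<^bsub>2,1\<^esub>\<close>.  Since the complement
  of a \<open>P\<^sub>4\<close> is a \<open>P\<^sub>4\<close> with inner and outer vertices exchanged, adding a nonadjacent twin of an end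
  vertex gives the complement of \<open>D\<^bsub>2,1\<^esub>\<close>.
\<close>

lemma isomorphic_D21:
  assumes "simple_graph G" "induced_path G a b c d" "v \<notin> {a, b, c, d}"
    "verts G = {v, a, b, c, d}" "adj G v a" "adj G v b" "adj G v c" "\<not> adj G v d"
  shows "isomorphic G D21"
proof (rule isomorphic_if_list[of "[c, b, v, d, a]" G "[1, 2, 3, 4, 5]" "D21"])
  show "\<forall>(u, u')\<in>set (zip [c, b, v, d, a] [1, 2, 3, 4, 5]).
      \<forall>(w, w')\<in>set (zip [c, b, v, d, a] [1, 2, 3, 4, 5]). adj G u w \<longleftrightarrow> adj (D21) u' w'"
    using assms(2-) no_loop[OF assms(1)]
    by (simp add: induced_path_def adj_commute[of G] adj_D21)
next
  show "set [1, 2, 3, 4, 5] = verts (D21)" by (auto simp: D21_def complement_def)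
qed (use assms in \<open>auto simp: induced_path_def\<close>)

lemma isomorphic_complement_D21:
  assumes "simple_graph G" "induced_path G a b c d" "v \<notin> {a, b, c, d}"
    "verts G = {v, a, b, c, d}" "\<not> adj G v a" "adj G v b" "\<not> adj G v c" "\<not> adj G v d"
  shows "isomorphic G (complement D21)"
proof (rule isomorphic_if_list[of "[d, a, v, b, c]" G "[1, 2, 3, 4, 5]" "complement D21"])
  show "\<forall>(u, u')\<in>set (zip [d, a, v, b, c] [1, 2, 3, 4, 5]).
      \<forall>(w, w')\<in>set (zip [d, a, v, b, c] [1, 2, 3, 4, 5]). adj G u w \<longleftrightarrow> adj (complement D21) u' w'"
    using assms(2-) no_loop[OF assms(1)]
    by (simp add: induced_path_def adj_commute[of G] adj_complement adj_D21 verts_D21)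
next
  show "set [1, 2, 3, 4, 5] = verts (complement D21)" by (auto simp: D21_def complement_def)
qed (use assms in \<open>auto simp: induced_path_def\<close>)

lemma tyshkevich_isomorphic:
  assumes S: "split_graph S K I" and H: "simple_graph H" and dj: "verts S \<inter> verts H = {}"
    and S': "split_graph S' K' I'" and H': "simple_graph H'" and dj': "verts S' \<inter> verts H' = {}"
    and f: "bij_betw f (verts S) (verts S')"
      "\<forall>u\<in>verts S. \<forall>v\<in>verts S. adj S u v \<longleftrightarrow> adj S' (f u) (f v)" and K: "f ` K = K'"
    and g: "bij_betw g (verts H) (verts H')"
      "\<forall>u\<in>verts H. \<forall>v\<in>verts H. adj H u v \<longleftrightarrow> adj H' (g u) (g v)"
  shows "isomorphic (tyshkevich S K H) (tyshkevich S' K' H')"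
proof -
  define h where "h = (\<lambda>x. if x \<in> verts S then f x else g x)"
  have hS: "h x = f x" if "x \<in> verts S" for x using that by (simp add: h_def)
  have hH: "h x = g x" if "x \<in> verts H" for x using that dj by (auto simp: h_def)
  have sS: "simple_graph S" "simple_graph S'" "K \<subseteq> verts S" "K' \<subseteq> verts S'"
    using S S' by (auto simp: split_graph_def)
  have fS: "f x \<in> verts S'" if "x \<in> verts S" for x using f(1) that by (auto simp: bij_betw_def)
  have gH: "g x \<in> verts H'" if "x \<in> verts H" for x using g(1) that by (auto simp: bij_betw_def)
  have fK: "f x \<in> K' \<longleftrightarrow> x \<in> K" if "x \<in> verts S" for x
    using that f(1) K sS(3) by (auto simp: bij_betw_def inj_on_def)
  have "bij_betw h (verts S) (verts S')" "bij_betw h (verts H) (verts H')"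
    using f(1) g(1) hS hH by (auto cong: bij_betw_cong)
  then have "bij_betw h (verts S \<union> verts H) (verts S' \<union> verts H')"
    using dj' by (rule bij_betw_combine)
  moreover have "adj (tyshkevich S K H) u v \<longleftrightarrow> adj (tyshkevich S' K' H') (h u) (h v)"
    if uv: "u \<in> verts S \<union> verts H" "v \<in> verts S \<union> verts H" for u v
  proof -
    have out: "\<not> adj X x y" "\<not> adj X y x" if "simple_graph X" "x \<notin> verts X" for X :: "'z sgraph" and x y
      using adj_in_verts(1,2)[OF that(1)] that(2) by blast+
    have sep: "x \<in> verts S \<Longrightarrow> x \<notin> verts H" "x \<in> verts H \<Longrightarrow> x \<notin> verts S \<and> x \<notin> K"
      "x' \<in> verts S' \<Longrightarrow> x' \<notin> verts H'" "x' \<in> verts H' \<Longrightarrow> x' \<notin> verts S' \<and> x' \<notin> K'" for x x'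
      using dj dj' sS(3,4) by blast+
    note simps = adj_tyshkevich hS hH fS gH fK sep out[OF sS(1)] out[OF sS(2)] out[OF H] out[OF H']
    consider "u \<in> verts S" "v \<in> verts S" | "u \<in> verts S" "v \<in> verts H"
      | "u \<in> verts H" "v \<in> verts S" | "u \<in> verts H" "v \<in> verts H" using uv by blast
    then show ?thesis using f(2) g(2) by cases (simp_all add: simps)
  qed
  ultimately show ?thesis unfolding isomorphic_def adj_def
    by (intro exI[of _ h]) (simp add: tyshkevich_def)
qed

section \<open>Counting switches\<close>

lemma switch_in_two_switches:
  "can_switch G a b x y \<Longrightarrow> ({{a, b}, {x, y}}, {{a, x}, {b, y}}) \<in> two_switches G"
  unfolding two_switches_def by blast

text \<open>The four vertices of a switch can be read off from its deleted edges alone.\<close>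

definition support :: "'a set set \<times> 'a set set \<Rightarrow> 'a set" where
  "support s = \<Union> (fst s)"

lemma support_switch: "support ({{a, b}, {x, y}}, A) = {a, b, x, y}"
  by (auto simp: support_def)

text \<open>
  In a \<open>C\<^sub>4\<close> the pair \<open>ay\<close>, \<open>bx\<close> can take over the role of the two edges, and in a \<open>2K\<^sub>2\<close> the
  role of the two non-edges; either exchange yields a second switch on the same vertices.
\<close>

lemma path_or_two_on_support:
  assumes "can_switch G a b x y"
  shows "(\<exists>p q r s. induced_path G p q r s \<and> {p, q, r, s} = {a, b, x, y}) \<or>
    ((adj G a y \<longleftrightarrow> adj G b x) \<and> (\<exists>s\<in>two_switches G. \<exists>t\<in>two_switches G. s \<noteq> t \<and>
       support s = {a, b, x, y} \<and> support t = {a, b, x, y}))"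
proof -
  note ab = assms[unfolded can_switch_iff]
  consider "adj G b x" "\<not> adj G a y" | "adj G a y" "\<not> adj G b x" | "adj G a y" "adj G b x"
    | "\<not> adj G a y" "\<not> adj G b x" by blast
  then show ?thesis
  proof cases
    case 1
    then have "induced_path G a b x y" using ab by (simp add: induced_path_def)
    then show ?thesis by blast
  next
    case 2
    then have "induced_path G b a y x" using ab by (auto simp: induced_path_def adj_commute)
    then show ?thesis by blast
  next
    case 3
    then have "can_switch G a y x b"
      using ab by (auto simp: can_switch_iff adj_commute)
    from switch_in_two_switches[OF this] switch_in_two_switches[OF assms] 3 ab show ?thesis
      by (intro disjI2 conjI bexI[of _ "({{a, b}, {x, y}}, {{a, x}, {b, y}})"]
          bexI[of _ "({{a, y}, {x, b}}, {{a, x}, {y, b}})"])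
        (auto simp: support_switch doubleton_eq_iff)
  next
    case 4
    then have "can_switch G a b y x"
      using ab by (auto simp: can_switch_iff adj_commute)
    from switch_in_two_switches[OF this] switch_in_two_switches[OF assms] 4 ab show ?thesis
      by (intro disjI2 conjI bexI[of _ "({{a, b}, {x, y}}, {{a, x}, {b, y}})"]
          bexI[of _ "({{a, b}, {y, x}}, {{a, y}, {b, x}})"])
        (auto simp: support_switch doubleton_eq_iff)
  qed
qed

text \<open>
  The path \<open>a b c d\<close> has the edges \<open>ab\<close>, \<open>bc\<close>, \<open>cd\<close> and the non-edges \<open>ac\<close>, \<open>ad\<close>, \<open>bd\<close>.  In
  both triples the middle pair meets the other two, so there is only one choice of two
  disjoint edges and only one choice of two disjoint non-edges.
\<close>

lemma induced_path_switch_unique: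
  assumes "induced_path G a b c d" "can_switch G p q r s" "{p, q, r, s} = {a, b, c, d}"
  shows "({{p, q}, {r, s}}, {{p, r}, {q, s}}) = ({{a, b}, {c, d}}, {{a, c}, {b, d}})"
proof -
  note path = assms(1)[unfolded induced_path_def] and sw = assms(2)[unfolded can_switch_iff]
  have mem: "p \<in> {a, b, c, d}" "q \<in> {a, b, c, d}" "r \<in> {a, b, c, d}" "s \<in> {a, b, c, d}"
    using assms(3) by blast+
  have edge: "{u, v} = {a, b} \<or> {u, v} = {b, c} \<or> {u, v} = {c, d}"
    if "u \<in> {a, b, c, d}" "v \<in> {a, b, c, d}" "u \<noteq> v" "adj G u v" for u v
    using that path by (elim insertE) (simp_all add: insert_commute adj_commute)
  have nonedge: "{u, v} = {a, c} \<or> {u, v} = {a, d} \<or> {u, v} = {b, d}"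
    if "u \<in> {a, b, c, d}" "v \<in> {a, b, c, d}" "u \<noteq> v" "\<not> adj G u v" for u v
    using that path by (elim insertE) (simp_all add: insert_commute adj_commute)
  have pair: "{X, Y} = {A, C}" if "X = A \<or> X = B \<or> X = C" "Y = A \<or> Y = B \<or> Y = C"
    "X \<inter> Y = {}" "A \<inter> B \<noteq> {}" "B \<inter> C \<noteq> {}" "X \<noteq> {}" for X Y A B C :: "'a set"
    using that by (elim disjE) (simp_all add: insert_commute Int_commute)
  have disj: "{p, q} \<inter> {r, s} = {}" "{p, r} \<inter> {q, s} = {}" using sw by auto
  have e: "p \<noteq> q" "adj G p q" "r \<noteq> s" "adj G r s"
    and n: "p \<noteq> r" "\<not> adj G p r" "q \<noteq> s" "\<not> adj G q s" using sw by simp_all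
  have "{{p, q}, {r, s}} = {{a, b}, {c, d}}"
    by (rule pair[OF edge[OF mem(1,2) e(1,2)] edge[OF mem(3,4) e(3,4)] disj(1)]) simp_all
  moreover have "{{p, r}, {q, s}} = {{a, c}, {b, d}}"
    by (rule pair[OF nonedge[OF mem(1,3) n(1,2)] nonedge[OF mem(2,4) n(3,4)] disj(2)]) simp_all
  ultimately show ?thesis by simp
qed

definition path_set :: "'a sgraph \<Rightarrow> 'a set \<Rightarrow> bool" where
  "path_set G P \<longleftrightarrow> (\<exists>a b c d. induced_path G a b c d \<and> {a, b, c, d} = P)"

lemma path_setE:
  assumes "path_set G P"
  obtains a b c d where "induced_path G a b c d" "P = {a, b, c, d}"
  using assms unfolding path_set_def by (elim exE conjE) (rule that, assumption, rule sym)

lemma two_switchesE: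
  assumes "s \<in> two_switches G"
  obtains a b x y where "can_switch G a b x y" "s = ({{a, b}, {x, y}}, {{a, x}, {b, y}})"
    "support s = {a, b, x, y}"
proof -
  obtain a b x y where "can_switch G a b x y" "s = ({{a, b}, {x, y}}, {{a, x}, {b, y}})"
    using assms unfolding two_switches_def by fast
  then show thesis using that[of a b x y] support_switch by metis
qed

lemma verts_covered:
  assumes "active G" "two_switches G \<subseteq> A" "v \<in> verts G"
  shows "v \<in> \<Union> (support ` A)"
proof -
  obtain a b x y where s: "can_switch G a b x y" "v \<in> {a, b, x, y}"
    using assms(1,3) unfolding active_def active_vertex_def by blast
  have "({{a, b}, {x, y}}, {{a, x}, {b, y}}) \<in> A"
    using switch_in_two_switches[OF s(1)] assms(2) by (rule subsetD[rotated])
  moreover have "v \<in> support ({{a, b}, {x, y}}, {{a, x}, {b, y}})"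
    using s(2) by (simp add: support_switch)
  ultimately show ?thesis by (rule UN_I)
qed

lemma switch_degree_one:
  assumes "simple_graph G" "active G" "switch_degree G = 1"
  shows "isomorphic G P4"
proof -
  obtain s where s: "two_switches G = {s}"
    using assms(3) unfolding switch_degree_def by (rule card_1_singletonE)
  from s have "s \<in> two_switches G" by simp
  then obtain a b x y where ab: "can_switch G a b x y" "support s = {a, b, x, y}"
    by (rule two_switchesE)
  have "v \<in> support s" if "v \<in> verts G" for v
    using verts_covered[OF assms(2) _ that, of "{s}"] s by simp
  then have V: "verts G = {a, b, x, y}"
    using ab(2) can_switch_in_verts[OF assms(1) ab(1)] by blast
  obtain p q r t where pq: "induced_path G p q r t" "{p, q, r, t} = {a, b, x, y}"
    using path_or_two_on_support[OF ab(1)] unfolding s by blast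
  show ?thesis by (rule isomorphic_P4[OF assms(1) pq(1)]) (simp only: V pq(2))
qed

definition two_paths :: "'a sgraph \<Rightarrow> 'a set \<Rightarrow> 'a set \<Rightarrow> bool" where
  "two_paths G P Q \<longleftrightarrow> P \<noteq> Q \<and> verts G = P \<union> Q \<and>
     path_set G P \<and> path_set G Q \<and>
     (\<forall>a b x y. can_switch G a b x y \<longrightarrow> {a, b, x, y} = P \<or> {a, b, x, y} = Q)"

lemma two_pathsD:
  assumes "two_paths G P Q"
  shows "P \<noteq> Q" "verts G = P \<union> Q" "path_set G P" "path_set G Q"
    "can_switch G a b x y \<Longrightarrow> {a, b, x, y} = P \<or> {a, b, x, y} = Q"
  using assms unfolding two_paths_def by metis+

lemma two_paths_commute:
  assumes two: "two_paths G P Q"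
  shows "two_paths G Q P"
  unfolding two_paths_def
proof (intro conjI allI impI)
  show "verts G = Q \<union> P" using two_pathsD(2)[OF two] by (simp add: Un_commute)
  show "{a, b, x, y} = Q \<or> {a, b, x, y} = P" if "can_switch G a b x y" for a b x y
    using two_pathsD(5)[OF two that] by (rule disj_commute[THEN iffD1])
qed (use two_pathsD(1,3,4)[OF two] in simp_all)

text \<open>
  If the two switches have the same four vertices, the induced graph is not a path, since a path
  has only one switch.  If their vertex sets differ, neither set can carry a second switch,
  so both are paths.
\<close>

lemma switch_degree_two_cases:
  assumes sg: "simple_graph G" and act: "active G" and deg: "switch_degree G = 2"
  obtains (one) a b x y where "can_switch G a b x y" "verts G = {a, b, x, y}"
      "adj G a y \<longleftrightarrow> adj G b x"
    | (two) P Q where "two_paths G P Q"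
proof -
  obtain s t where st: "two_switches G = {s, t}" "s \<noteq> t"
    using deg unfolding switch_degree_def card_2_iff by (elim exE conjE)
  from st have mem: "s \<in> two_switches G" "t \<in> two_switches G" by simp_all
  from mem(1) obtain a b x y where ab: "can_switch G a b x y"
      "s = ({{a, b}, {x, y}}, {{a, x}, {b, y}})" "support s = {a, b, x, y}"
    by (rule two_switchesE)
  from mem(2) obtain p q r u where pq: "can_switch G p q r u"
      "t = ({{p, q}, {r, u}}, {{p, r}, {q, u}})" "support t = {p, q, r, u}"
    by (rule two_switchesE)
  have "v \<in> support s \<union> support t" if "v \<in> verts G" for v
    using verts_covered[OF act _ that, of "{s, t}"] st(1) by simp
  then have V: "verts G = {a, b, x, y} \<union> {p, q, r, u}"
    using ab(3) pq(3) can_switch_in_verts[OF sg ab(1)] can_switch_in_verts[OF sg pq(1)] by blast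
  show thesis
  proof (cases "{a, b, x, y} = {p, q, r, u}")
    case True
    have "\<not> induced_path G a' b' c' d'" if "{a', b', c', d'} = {a, b, x, y}" for a' b' c' d'
    proof
      assume path: "induced_path G a' b' c' d'"
      have "s = t" unfolding ab(2) pq(2)
        using induced_path_switch_unique[OF path ab(1)] induced_path_switch_unique[OF path pq(1)]
          that True by simp
      then show False using st(2) by simp
    qed
    then have "adj G a y \<longleftrightarrow> adj G b x"
      using path_or_two_on_support[OF ab(1)] by blast
    then show thesis using one ab(1) V True by simp
  next
    case False
    have unique: "s' = t'"
      if "s' \<in> two_switches G" "t' \<in> two_switches G" "support s' = support t'" for s' t'
      using that False unfolding st(1) by (metis ab(3) pq(3) insertE singletonD)
    have P: "path_set G {a, b, x, y}"
      using path_or_two_on_support[OF ab(1)] unique unfolding path_set_def by metis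
    have Q: "path_set G {p, q, r, u}"
      using path_or_two_on_support[OF pq(1)] unique unfolding path_set_def by metis
    have only: "{a', b', x', y'} = {a, b, x, y} \<or> {a', b', x', y'} = {p, q, r, u}"
      if "can_switch G a' b' x' y'" for a' b' x' y'
      using switch_in_two_switches[OF that] st(1) ab(3) pq(3)
      by (metis insertE singletonD support_switch)
    have "two_paths G {a, b, x, y} {p, q, r, u}"
      unfolding two_paths_def using False V P Q only by (intro conjI allI impI)
    then show thesis by (rule two)
  qed
qed

section \<open>Decomposable graphs\<close>

lemma split_graphD:
  assumes "split_graph S K I"
  shows "simple_graph S" "verts S = K \<union> I" "K \<inter> I = {}"
    "u \<in> K \<Longrightarrow> v \<in> K \<Longrightarrow> u \<noteq> v \<Longrightarrow> adj S u v" "u \<in> I \<Longrightarrow> v \<in> I \<Longrightarrow> \<not> adj S u v"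
  using assms by (simp_all add: split_graph_def adj_def)

text \<open>
  Follow an alternating 4-cycle from a vertex \<open>p\<close> of \<open>H\<close> that has a neighbour on the
  cycle outside \<open>H\<close>.  An edge leads from \<open>H\<close> into \<open>K\<close>, a non-edge from \<open>K\<close> into \<open>I\<close>, an edge
  from \<open>I\<close> into \<open>K\<close>, and the closing non-edge would join \<open>K\<close> to \<open>H\<close>, where everything is
  adjacent.  If the cycle leaves \<open>H\<close> along a non-edge, it visits \<open>I\<close>, \<open>K\<close>, \<open>I\<close> and would have
  to return to \<open>H\<close> from \<open>I\<close> along an edge.
\<close>

lemma can_switch_tyshkevich:
  assumes S: "split_graph S K I" and H: "simple_graph H" and dj: "verts S \<inter> verts H = {}"
    and sw: "can_switch (tyshkevich S K H) a b x y"
  shows "{a, b, x, y} \<subseteq> verts S \<or> {a, b, x, y} \<subseteq> verts H"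
proof -
  let ?T = "tyshkevich S K H"
  note s = split_graphD[OF S]
  note out = adj_in_verts(1,2)[OF s(1)] adj_in_verts(1,2)[OF H]
  have clique: "adj ?T u v" if "u \<in> K" "v \<in> K" "u \<noteq> v" for u v
    using s(4)[OF that] by (simp add: adj_tyshkevich)
  have join: "adj ?T u v" "adj ?T v u" if "u \<in> K" "v \<in> verts H" for u v
    using that by (simp_all add: adj_tyshkevich)
  have indep: "\<not> adj ?T u v" if "u \<in> I" "v \<in> I" for u v
  proof -
    have "\<not> adj S u v" by (rule s(5)[OF that])
    moreover have "u \<notin> verts H" "v \<notin> verts H" using that s(2) dj by auto
    ultimately show ?thesis using out(3) by (auto simp: adj_tyshkevich)
  qed
  have apart: "\<not> adj ?T u v" "\<not> adj ?T v u" if "u \<in> I" "v \<in> verts H" for u v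
  proof -
    have "u \<notin> verts H" "v \<notin> verts S" "u \<notin> K" using that s(2,3) dj by auto
    then show "\<not> adj ?T u v" "\<not> adj ?T v u"
      using out s(2) by (auto simp: adj_tyshkevich)
  qed
  have mem: "z \<in> K \<or> z \<in> I \<or> z \<in> verts H" if "z \<in> {a, b, x, y}" for z
  proof -
    \<comment> \<open>Every vertex of the cycle has an edge there, and both ends of an edge are vertices.\<close>
    have "adj ?T z (if z = a then b else if z = b then a else if z = x then y else x)"
      using sw that by (auto simp: can_switch_iff adj_commute[of ?T])
    then show ?thesis using out s(2) by (auto simp: adj_tyshkevich)
  qed
  have edge: "q \<in> verts H" if "can_switch ?T p q r t" "{p, q, r, t} = {a, b, x, y}" "p \<in> verts H"
    for p q r t
  proof (rule ccontr)
    assume q: "q \<notin> verts H"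
    note c = that(1)[unfolded can_switch_iff]
    have m: "q \<in> {a, b, x, y}" "r \<in> {a, b, x, y}" "t \<in> {a, b, x, y}" using that(2) by blast+
    have "q \<in> K" using mem[OF m(1)] q apart(2)[of q p] c that(3) by blast
    then have "t \<in> I" using mem[OF m(3)] join(1)[of q t] clique[of q t] c by auto
    then have "r \<in> K" using mem[OF m(2)] indep[of r t] apart(2)[of t r] c by blast
    then show False using join(2)[of r p] that(3) c by blast
  qed
  have nonedge: "r \<in> verts H" if "can_switch ?T p q r t" "{p, q, r, t} = {a, b, x, y}" "p \<in> verts H"
    for p q r t
  proof (rule ccontr)
    assume r: "r \<notin> verts H"
    note c = that(1)[unfolded can_switch_iff]
    have m: "q \<in> {a, b, x, y}" "r \<in> {a, b, x, y}" "t \<in> {a, b, x, y}" using that(2) by blast+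
    have "r \<in> I" using mem[OF m(2)] r join(2)[of r p] c that(3) by blast
    then have "t \<in> K" using mem[OF m(3)] indep[of r t] apart(1)[of r t] c by blast
    then have "q \<in> I" using mem[OF m(1)] join(2)[of t q] clique[of q t] c by auto
    then show False using apart(2)[of q p] that(3) c by blast
  qed
  have sws: "can_switch ?T b a y x" "can_switch ?T x y a b" "can_switch ?T y x b a"
    using sw by (auto simp: can_switch_iff adj_commute[of ?T])
  have perm: "{b, a, y, x} = {a, b, x, y}" "{x, y, a, b} = {a, b, x, y}" "{y, x, b, a} = {a, b, x, y}"
    by auto
  have "a \<in> verts H \<longleftrightarrow> b \<in> verts H"
    using edge[OF sw refl] edge[OF sws(1) perm(1)] by blast
  moreover have "x \<in> verts H \<longleftrightarrow> y \<in> verts H"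
    using edge[OF sws(2) perm(2)] edge[OF sws(3) perm(3)] by blast
  moreover have "a \<in> verts H \<longleftrightarrow> x \<in> verts H"
    using nonedge[OF sw refl] nonedge[OF sws(2) perm(2)] by blast
  ultimately have "z \<in> verts H \<longleftrightarrow> a \<in> verts H" if "z \<in> {a, b, x, y}" for z
    using that by blast
  then show ?thesis using mem s(2) by blast
qed

lemma split_induced_path:
  assumes "split_graph S K I" "induced_path S a b c d" "verts S = {a, b, c, d}"
  shows "K = {b, c}"
proof -
  note s = split_graphD[OF assms(1)]
  note p = assms(2)[unfolded induced_path_def]
  have "a \<in> K \<or> a \<in> I" "b \<in> K \<or> b \<in> I" "c \<in> K \<or> c \<in> I" "d \<in> K \<or> d \<in> I"
    using s(2) assms(3) by blast+
  moreover have "\<not> (a \<in> K \<and> c \<in> K)" "\<not> (a \<in> K \<and> d \<in> K)" "\<not> (b \<in> K \<and> d \<in> K)"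
    using s(4) p by auto
  moreover have "\<not> (a \<in> I \<and> b \<in> I)" "\<not> (c \<in> I \<and> d \<in> I)"
    using s(5) p by blast+
  ultimately have "a \<in> I" "b \<in> K" "c \<in> K" "d \<in> I" by blast+
  moreover from this have "K \<subseteq> {a, b, c, d}" "a \<notin> K" "d \<notin> K" using s(2,3) assms(3) by blast+
  ultimately show ?thesis by auto
qed

lemma decomposable_switch_degree_two:
  assumes sg: "simple_graph G" and act: "active G" and deg: "switch_degree G = 2"
    and dec: "decomposable G"
  shows "isomorphic G P4_squared"
proof -
  obtain S K I H where S: "split_graph S K I" and H: "simple_graph H"
    and dj: "verts S \<inter> verts H = {}" and G: "G = tyshkevich S K H"
    using dec unfolding decomposable_def by blast
  have sS: "simple_graph S" "K \<subseteq> verts S" using S by (auto simp: split_graph_def)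
  have V: "verts G = verts S \<union> verts H" by (simp add: G tyshkevich_def)
  have ne: "verts S \<noteq> {}" "verts H \<noteq> {}" using sS(1) H by (auto simp: simple_graph_def)
  have side: "{a, b, x, y} \<subseteq> verts S \<or> {a, b, x, y} \<subseteq> verts H" if "can_switch G a b x y" for a b x y
    using can_switch_tyshkevich[OF S H dj] that G by simp
  obtain P Q where two: "two_paths G P Q" and PQ: "P = verts S" "Q = verts H"
    using sg act deg
  proof (cases rule: switch_degree_two_cases)
    case (one a b x y)
    then show ?thesis using side[OF one(1)] V dj ne by blast
  next
    case (two P Q)
    have "X \<subseteq> verts S \<or> X \<subseteq> verts H" if "path_set G X" for X
      using that side induced_path_can_switch unfolding path_set_def by metis
    then have sP: "P \<subseteq> verts S \<or> P \<subseteq> verts H" and sQ: "Q \<subseteq> verts S \<or> Q \<subseteq> verts H"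
      using two_pathsD(3,4)[OF two] by simp_all
    have "P \<union> Q = verts S \<union> verts H" using two_pathsD(2)[OF two] V by simp
    then have "P = verts S \<and> Q = verts H \<or> P = verts H \<and> Q = verts S"
      using sP sQ dj ne by blast
    then show ?thesis using two two_paths_commute[OF two] that by blast
  qed
  obtain a b c d where P: "induced_path G a b c d" "verts S = {a, b, c, d}"
    using two_pathsD(3)[OF two] unfolding PQ by (rule path_setE)
  obtain p q r s where Q: "induced_path G p q r s" "verts H = {p, q, r, s}"
    using two_pathsD(4)[OF two] unfolding PQ by (rule path_setE)
  have adjS: "adj G u v \<longleftrightarrow> adj S u v" if "u \<in> verts S" "v \<in> verts S" for u v
    using that dj adj_in_verts(1)[OF H] by (auto simp: G adj_tyshkevich)
  have adjH: "adj G u v \<longleftrightarrow> adj H u v" if "u \<in> verts H" "v \<in> verts H" for u v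
    using that dj sS(2) adj_in_verts(1)[OF sS(1)] by (auto simp: G adj_tyshkevich)
  have pS: "induced_path S a b c d" using P by (auto simp: induced_path_def adjS)
  have pH: "induced_path H p q r s" using Q by (auto simp: induced_path_def adjH)
  have labels: "distinct [1, 2, 3, 4 :: nat]" "distinct [5, 6, 7, 8 :: nat]" by simp_all
  obtain f where f: "map f [a, b, c, d] = [1, 2, 3, 4 :: nat]"
      "bij_betw f (verts S) (verts (path4 1 2 3 4))"
      "\<forall>u\<in>verts S. \<forall>v\<in>verts S. adj S u v \<longleftrightarrow> adj (path4 1 2 3 4) (f u) (f v)"
    by (rule induced_path_iso_path4[OF sS(1) pS P(2) labels(1)])
  obtain g where g: "bij_betw g (verts H) (verts (path4 5 6 7 8 :: nat sgraph))"
      "\<forall>u\<in>verts H. \<forall>v\<in>verts H. adj H u v \<longleftrightarrow> adj (path4 5 6 7 8) (g u) (g v)"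
    by (rule induced_path_iso_path4[OF H pH Q(2) labels(2)])
  have K: "f ` K = {2, 3}" using split_induced_path[OF S pS P(2)] f(1) by auto
  have sp4: "simple_graph (path4 i j k l)" if "distinct [i, j, k, l]" for i j k l :: nat
    using that unfolding simple_graph_def path4_def by simp
  have split: "split_graph (path4 1 2 3 4) {2, 3} {1, 4 :: nat}"
    using sp4[OF labels(1)] by (auto simp: split_graph_def path4_def doubleton_eq_iff)
  have dj': "verts (path4 1 2 3 4) \<inter> verts (path4 5 6 7 8 :: nat sgraph) = {}"
    by (simp add: path4_def)
  show ?thesis unfolding G P4_squared_def
    by (rule tyshkevich_isomorphic[OF S H dj split sp4[OF labels(2)] dj' f(2,3) K g])
qed

text \<open>The factors are the subgraphs induced on \<open>K \<union> I\<close> and on \<open>Y\<close>.\<close>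

lemma decomposableI:
  assumes sg: "simple_graph G" and V: "verts G = (K \<union> I) \<union> Y"
    and dj: "K \<inter> I = {}" "(K \<union> I) \<inter> Y = {}" and ne: "K \<union> I \<noteq> {}" "Y \<noteq> {}"
    and clique: "\<And>u v. u \<in> K \<Longrightarrow> v \<in> K \<Longrightarrow> u \<noteq> v \<Longrightarrow> adj G u v"
    and indep: "\<And>u v. u \<in> I \<Longrightarrow> v \<in> I \<Longrightarrow> \<not> adj G u v"
    and join: "\<And>u v. u \<in> K \<Longrightarrow> v \<in> Y \<Longrightarrow> adj G u v"
    and apart: "\<And>u v. u \<in> I \<Longrightarrow> v \<in> Y \<Longrightarrow> \<not> adj G u v"
  shows "decomposable G"
proof -
  define ind where "ind X = \<lparr>verts = X, edges = {e \<in> edges G. e \<subseteq> X}\<rparr>" for X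
  have edgeE: "\<exists>u v. u \<noteq> v \<and> e = {u, v} \<and> u \<in> verts G \<and> v \<in> verts G" if "e \<in> edges G" for e
    using sg that unfolding simple_graph_def by metis
  have ind: "simple_graph (ind X)" if "X \<subseteq> verts G" "X \<noteq> {}" for X
    using sg that edgeE finite_subset[OF that(1)]
    unfolding simple_graph_def ind_def by fastforce
  have "split_graph (ind (K \<union> I)) K I"
    using ind[of "K \<union> I"] V ne dj clique indep
    by (auto simp: split_graph_def ind_def adj_def)
  moreover have "simple_graph (ind Y)" using ind[of Y] V ne by blast
  moreover have "verts (ind (K \<union> I)) \<inter> verts (ind Y) = {}" using dj by (simp add: ind_def)
  moreover have "G = tyshkevich (ind (K \<union> I)) K (ind Y)"
  proof -
    have "edges G = {e \<in> edges G. e \<subseteq> K \<union> I} \<union> {e \<in> edges G. e \<subseteq> Y} \<union>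
        {{x, y} | x y. x \<in> K \<and> y \<in> Y}" (is "_ = ?R")
    proof
      show "?R \<subseteq> edges G" using join by (auto simp: adj_def)
      show "edges G \<subseteq> ?R"
      proof
        fix e assume e: "e \<in> edges G"
        then obtain u v where uv: "e = {u, v}" "u \<in> verts G" "v \<in> verts G" using edgeE by blast
        have a: "adj G u v" "adj G v u" using e uv(1) by (auto simp: adj_def insert_commute)
        consider "u \<in> K \<union> I" "v \<in> K \<union> I" | "u \<in> Y" "v \<in> Y" | "u \<in> K" "v \<in> Y" | "v \<in> K" "u \<in> Y"
          using uv V a apart by blast
        then show "e \<in> ?R" using e unfolding uv(1) by cases (auto simp: insert_commute)
      qed
    qed
    then show ?thesis using V by (simp add: tyshkevich_def ind_def)
  qed
  ultimately show ?thesis unfolding decomposable_def by blast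
qed

section \<open>Two induced paths\<close>

text \<open>
  The neighbourhood of \<open>v\<close> in the path \<open>a b c d\<close> is empty, \<open>{b, c}\<close>, or the whole path.  These are
  the neighbourhoods for which \<open>v\<close> lies on no alternating 4-cycle together with three vertices of
  the path.
\<close>

definition level :: "'a sgraph \<Rightarrow> 'a \<Rightarrow> 'a \<Rightarrow> 'a \<Rightarrow> 'a \<Rightarrow> 'a \<Rightarrow> bool" where
  "level G v a b c d \<longleftrightarrow> (adj G v a \<longleftrightarrow> adj G v d) \<and> (adj G v b \<longleftrightarrow> adj G v c) \<and>
     (adj G v a \<longrightarrow> adj G v b)"

text \<open>
  Omitting one vertex of the path from the five leaves four vertices, and the conditions in
  \<open>T1\<close> to \<open>T4\<close> say when these four carry an alternating 4-cycle.  The four sets are different, but all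
  of them would have to be \<open>Q\<close>; so at most one of the four conditions holds.  If none holds, \<open>v\<close> is
  level, and if exactly one holds, \<open>v\<close> is a twin of the omitted vertex.
\<close>

lemma induced_path_extension:
  assumes path: "induced_path G a b c d" and v: "v \<notin> {a, b, c, d}"
    and only: "\<And>p q r s. can_switch G p q r s \<Longrightarrow> v \<in> {p, q, r, s} \<Longrightarrow> {p, q, r, s} = Q"
  obtains (level) "level G v a b c d"
    | (end1) "Q = {v, b, c, d}" "\<not> adj G v a" "adj G v b" "\<not> adj G v c" "\<not> adj G v d"
    | (end2) "Q = {v, c, b, a}" "\<not> adj G v d" "adj G v c" "\<not> adj G v b" "\<not> adj G v a"
    | (inner1) "Q = {a, v, c, d}" "adj G v a" "adj G v b" "adj G v c" "\<not> adj G v d"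
    | (inner2) "Q = {d, v, b, a}" "adj G v d" "adj G v c" "adj G v b" "\<not> adj G v a"
proof -
  note p = path[unfolded induced_path_def]
  note sw = can_switch_iff adj_commute
  have T1: "Q = {v, c, b, a}" if "adj G v a \<or> adj G v c" "\<not> adj G v b"
    using only[of v a b c] only[of v c b a] that p v by (auto simp: sw)
  have T4: "Q = {v, b, c, d}" if "adj G v d \<or> adj G v b" "\<not> adj G v c"
    using only[of v d c b] only[of v b c d] that p v by (auto simp: sw)
  have T2: "Q = {d, v, b, a}" if "adj G v d" "\<not> (adj G v a \<and> adj G v b)"
    using only[of v d a b] only[of v d b a] that p v by (auto simp: sw)
  have T3: "Q = {a, v, c, d}" if "adj G v a" "\<not> (adj G v d \<and> adj G v c)"
    using only[of v a d c] only[of v a c d] that p v by (auto simp: sw)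
  have ne: "{v, c, b, a} \<noteq> {v, b, c, d}" "{v, c, b, a} \<noteq> {d, v, b, a}" "{v, c, b, a} \<noteq> {a, v, c, d}"
    "{v, b, c, d} \<noteq> {d, v, b, a}" "{v, b, c, d} \<noteq> {a, v, c, d}" "{d, v, b, a} \<noteq> {a, v, c, d}"
    using p v by auto
  show thesis
    using T1 T2 T3 T4 ne level end1 end2 inner1 inner2 unfolding level_def by metis
qed

text \<open>
  When \<open>v\<close> is a twin of a vertex of \<open>P\<close>, the set \<open>Q\<close> arises from \<open>P\<close> by exchanging the two, so
  the graph has no further vertices.
\<close>

lemma level_or_five_vertices:
  assumes sg: "simple_graph G" and two: "two_paths G P Q"
    and P: "induced_path G a b c d" "P = {a, b, c, d}" and v: "v \<in> Q - P"
  shows "level G v a b c d \<or> isomorphic G D21 \<or> isomorphic G (complement D21)"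
proof -
  have V: "verts G = {a, b, c, d} \<union> Q" and v': "v \<notin> {a, b, c, d}" "v \<notin> {d, c, b, a}"
    using two_pathsD(2)[OF two] P v by auto
  have only: "{p, q, r, s} = Q" if "can_switch G p q r s" "v \<in> {p, q, r, s}" for p q r s
    using two_pathsD(5)[OF two that(1)] v that(2) by blast
  note rev = induced_path_rev[OF P(1)]
  show ?thesis
  proof (rule induced_path_extension[OF P(1) v'(1) only])
    assume "Q = {v, b, c, d}"
    then have "verts G = {v, a, b, c, d}" using V by auto
    moreover assume "\<not> adj G v a" "adj G v b" "\<not> adj G v c" "\<not> adj G v d"
    ultimately show ?thesis using isomorphic_complement_D21[OF sg P(1) v'(1)] by simp
  next
    assume "Q = {v, c, b, a}"
    then have "verts G = {v, d, c, b, a}" using V by auto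
    moreover assume "\<not> adj G v d" "adj G v c" "\<not> adj G v b" "\<not> adj G v a"
    ultimately show ?thesis using isomorphic_complement_D21[OF sg rev v'(2)] by simp
  next
    assume "Q = {a, v, c, d}"
    then have "verts G = {v, a, b, c, d}" using V by auto
    moreover assume "adj G v a" "adj G v b" "adj G v c" "\<not> adj G v d"
    ultimately show ?thesis using isomorphic_D21[OF sg P(1) v'(1)] by simp
  next
    assume "Q = {d, v, b, a}"
    then have "verts G = {v, d, c, b, a}" using V by auto
    moreover assume "adj G v d" "adj G v c" "adj G v b" "\<not> adj G v a"
    ultimately show ?thesis using isomorphic_D21[OF sg rev v'(2)] by simp
  qed simp_all
qed

lemma induced_path_no_twins:
  assumes "induced_path G p q r s" "x \<in> {p, q, r, s}" "y \<in> {p, q, r, s}" "x \<noteq> y"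
  shows "\<exists>z\<in>{p, q, r, s} - {x, y}. adj G z x \<noteq> adj G z y"
proof (rule ccontr)
  assume "\<not> ?thesis"
  then have "z \<noteq> x \<longrightarrow> z \<noteq> y \<longrightarrow> (adj G z x \<longleftrightarrow> adj G z y)" if "z \<in> {p, q, r, s}" for z
    using that by blast
  note twins = this[of p] this[of q] this[of r] this[of s]
  have "distinct [p, q, r, s]" "distinct [s, r, q, p]"
    using assms(1) by (auto simp: induced_path_def)
  with twins show False
    using assms unfolding induced_path_def by (elim insertE) (simp_all add: adj_commute)
qed

text \<open>
  The reversal \<open>f\<close> of the path \<open>P\<close>, extended by the identity, preserves adjacency, because level vertices
  do not distinguish \<open>a\<close> from \<open>d\<close> or \<open>b\<close> from \<open>c\<close>.  It therefore maps the switch on \<open>Q\<close> to a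
  switch, whose vertex set must be \<open>Q\<close> again.  So \<open>P \<inter> Q\<close> is a union of the orbits \<open>{a, d}\<close>
  and \<open>{b, c}\<close>.  It is not all of \<open>P\<close>, and a single orbit would be a pair of twins in the path \<open>Q\<close>.
\<close>

lemma level_paths_disjoint:
  assumes two: "two_paths G P Q" and P: "induced_path G a b c d" "P = {a, b, c, d}"
    and lev: "\<And>v. v \<in> Q - P \<Longrightarrow> level G v a b c d"
  shows "P \<inter> Q = {}"
proof -
  obtain p q r s where Q: "induced_path G p q r s" "Q = {p, q, r, s}"
    using two_pathsD(4)[OF two] by (rule path_setE)
  note pP = P(1)[unfolded induced_path_def]
  define f where "f x = (if x = a then d else if x = d then a else if x = b then c
    else if x = c then b else x)" for x
  have fv: "f a = d" "f d = a" "f b = c" "f c = b" "\<And>x. x \<notin> P \<Longrightarrow> f x = x"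
    using pP P(2) by (auto simp: f_def)
  have ff: "f (f x) = x" for x using pP by (auto simp: f_def)
  have aut: "adj G (f x) (f y) \<longleftrightarrow> adj G x y" if xy: "x \<in> Q" "y \<in> Q" "x \<noteq> y" for x y
  proof -
    have one: "adj G (f x) (f y) \<longleftrightarrow> adj G x y" if "x \<in> P" "y \<in> Q - P" for x y
    proof -
      have "adj G y (f x) \<longleftrightarrow> adj G y x"
        using that(1) lev[OF that(2)] unfolding level_def P(2)
        by (elim insertE) (simp_all add: fv(1-4))
      then show ?thesis using fv(5)[of y] that(2) by (simp add: adj_commute)
    qed
    consider "x \<in> P" "y \<in> P" | "x \<in> P" "y \<in> Q - P" | "y \<in> P" "x \<in> Q - P" | "x \<notin> P" "y \<notin> P"
      using xy by blast
    then show ?thesis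
    proof cases
      case 1
      then show ?thesis using pP xy(3) unfolding P(2)
        by (elim insertE) (simp_all add: fv(1-4) adj_commute)
    next
      case 2 then show ?thesis by (rule one)
    next
      case 3 then show ?thesis using one[OF 3] by (simp add: adj_commute)
    next
      case 4 then show ?thesis by (simp add: fv(5))
    qed
  qed
  have dist: "f x \<noteq> f y" if "x \<noteq> y" for x y using that ff by metis
  have "can_switch G (f p) (f q) (f r) (f s)"
    using induced_path_can_switch[OF Q(1)] aut dist unfolding can_switch_iff Q(2) by auto
  then have "{f p, f q, f r, f s} = P \<or> {f p, f q, f r, f s} = Q"
    by (rule two_pathsD(5)[OF two])
  then have "f ` Q = P \<or> f ` Q = Q" using Q(2) by auto
  moreover have "f ` P = P" using fv(1-4) P(2) by auto
  moreover have "f ` f ` Q = Q" using ff by (simp add: image_image)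
  moreover have "P \<noteq> Q" by (rule two_pathsD(1)[OF two])
  ultimately have fQ: "f ` Q = Q" by metis
  have inv: "a \<in> Q \<longleftrightarrow> d \<in> Q" "b \<in> Q \<longleftrightarrow> c \<in> Q" using fQ fv(1-4) by (metis imageI)+
  have "card P = 4" "card Q = 4" using P Q by (auto simp: induced_path_def)
  then have nsub: "\<not> P \<subseteq> Q"
    using card_subset_eq[of Q P] Q(2) \<open>P \<noteq> Q\<close> by auto
  have notwin: "\<not> (x \<in> Q \<and> y \<in> Q)"
    if "x \<noteq> y" "P \<inter> Q \<subseteq> {x, y}" "\<And>v. v \<in> Q - P \<Longrightarrow> adj G v x \<longleftrightarrow> adj G v y" for x y
    using induced_path_no_twins[OF Q(1), of x y] that unfolding Q(2) by blast
  have "\<not> (a \<in> Q \<and> d \<in> Q)"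
  proof
    assume *: "a \<in> Q \<and> d \<in> Q"
    then have "P \<inter> Q \<subseteq> {a, d}" using inv nsub P(2) by auto
    then show False using notwin[of a d] * lev pP unfolding level_def by auto
  qed
  moreover have "\<not> (b \<in> Q \<and> c \<in> Q)"
  proof
    assume *: "b \<in> Q \<and> c \<in> Q"
    then have "P \<inter> Q \<subseteq> {b, c}" using inv nsub P(2) by auto
    then show False using notwin[of b c] * lev pP unfolding level_def by auto
  qed
  ultimately show ?thesis using inv P(2) by auto
qed

text \<open>
  As the paths are level to each other, whether \<open>u \<in> P\<close> and \<open>v \<in> Q\<close> are adjacent depends only on
  which of them are inner vertices, and it is monotone in this: exchanging an end for an inner
  vertex keeps adjacency.  The two mixed cases, \<open>a\<close> with \<open>q\<close> and \<open>b\<close> with \<open>p\<close>, decide everything.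
  If neither is an edge, then \<open>ab\<close> and \<open>pq\<close> form the edges of a switch with \<open>aq\<close>, \<open>bp\<close>; if both
  are, then \<open>ac\<close> and \<open>pr\<close> are the non-edges of a switch with \<open>ar\<close>, \<open>cp\<close>.  Both switches meet \<open>P\<close>
  and \<open>Q\<close>.  If exactly one is an edge, monotonicity makes all pairs of inner vertices adjacent
  and all pairs of ends nonadjacent, so the inner vertices of one path are joined to the entire
  other path and its ends to none of it.
\<close>

lemma level_paths_decomposable:
  assumes sg: "simple_graph G" and two: "two_paths G P Q" and dj: "P \<inter> Q = {}"
    and P: "induced_path G a b c d" "P = {a, b, c, d}"
    and Q: "induced_path G p q r s" "Q = {p, q, r, s}"
    and levP: "\<And>v. v \<in> Q \<Longrightarrow> level G v a b c d"
    and levQ: "\<And>v. v \<in> P \<Longrightarrow> level G v p q r s"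
  shows "decomposable G"
proof -
  note pP = P(1)[unfolded induced_path_def] and pQ = Q(1)[unfolded induced_path_def]
  have V: "verts G = P \<union> Q" by (rule two_pathsD(2)[OF two])
  have only: "{w, x, y, z} \<subseteq> P \<or> {w, x, y, z} \<subseteq> Q" if "can_switch G w x y z" for w x y z
    using two_pathsD(5)[OF two that] by blast
  have ne: "a \<noteq> p" "a \<noteq> q" "a \<noteq> r" "b \<noteq> p" "b \<noteq> q" "c \<noteq> p" "c \<noteq> r"
    "a \<in> P" "p \<in> Q" "a \<notin> Q" "p \<notin> P" using dj P(2) Q(2) by auto
  have lP: "adj G p d = adj G p a" "adj G p c = adj G p b" "adj G q d = adj G q a" "adj G q c = adj G q b"
      "adj G r d = adj G r a" "adj G r c = adj G r b" "adj G s d = adj G s a" "adj G s c = adj G s b"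
      "adj G p a \<longrightarrow> adj G p b" "adj G q a \<longrightarrow> adj G q b"
    using levP unfolding level_def Q(2) by blast+
  have lQ: "adj G s a = adj G p a" "adj G r a = adj G q a" "adj G s b = adj G p b" "adj G r b = adj G q b"
    "adj G p a \<longrightarrow> adj G q a" "adj G p b \<longrightarrow> adj G q b"
    using levQ[of a] levQ[of b] unfolding level_def P(2) by (auto simp: adj_commute)
  have not_both_out: "adj G q a \<or> adj G p b"
  proof (rule ccontr)
    assume "\<not> ?thesis"
    then have "can_switch G a b q p"
      using pP pQ ne by (auto simp: can_switch_iff adj_commute)
    then show False using only ne by blast
  qed
  have not_both_in: "\<not> (adj G q a \<and> adj G p b)"
  proof
    assume "adj G q a \<and> adj G p b"
    then have "can_switch G a r c p"
      using pP pQ ne lP lQ by (auto simp: can_switch_iff adj_commute)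
    then show False using only ne by blast
  qed
  show ?thesis
  proof (cases "adj G p b")
    case True
    then show ?thesis
      using not_both_in lP lQ pP pQ dj P(2) Q(2) V no_loop[OF sg]
      by (intro decomposableI[OF sg, of "{b, c}" "{a, d}" Q]) (auto simp: adj_commute)
  next
    case False
    then show ?thesis
      using not_both_out lP lQ pP pQ dj P(2) Q(2) V no_loop[OF sg]
      by (intro decomposableI[OF sg, of "{q, r}" "{p, s}" P]) (auto simp: adj_commute)
  qed
qed

lemma indecomposable_switch_degree_two:
  assumes sg: "simple_graph G" and act: "active G" and deg: "switch_degree G = 2"
    and indec: "indecomposable G"
  shows "isomorphic G D21 \<or> isomorphic G (complement D21) \<or> isomorphic G C4 \<or> isomorphic G two_K2"
  using sg act deg
proof (cases rule: switch_degree_two_cases)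
  case (one a b x y)
  then show ?thesis using isomorphic_C4[OF sg] isomorphic_two_K2[OF sg] by metis
next
  case (two P Q)
  obtain a b c d where P: "induced_path G a b c d" "P = {a, b, c, d}"
    using two_pathsD(3)[OF two] by (rule path_setE)
  obtain p q r s where Q: "induced_path G p q r s" "Q = {p, q, r, s}"
    using two_pathsD(4)[OF two] by (rule path_setE)
  show ?thesis
  proof (rule ccontr)
    assume other: "\<not> ?thesis"
    then have levP: "level G v a b c d" if "v \<in> Q - P" for v
      using level_or_five_vertices[OF sg two P that] by blast
    have levQ: "level G v p q r s" if "v \<in> P - Q" for v
      using level_or_five_vertices[OF sg two_paths_commute[OF two] Q that] other by blast
    have dj: "P \<inter> Q = {}" by (rule level_paths_disjoint[OF two P levP])
    then have "decomposable G"
      using level_paths_decomposable[OF sg two dj P Q] levP levQ by blast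
    then show False using indec by (simp add: indecomposable_def)
  qed
qed

theorem theorem3p1:
  fixes G :: "'a sgraph"
  assumes "simple_graph G" and "active G"
  shows "(switch_degree G = 1 \<longrightarrow> isomorphic G P4) \<and>
    (switch_degree G = 2 \<and> decomposable G \<longrightarrow> isomorphic G P4_squared) \<and>
    (switch_degree G = 2 \<and> indecomposable G \<longrightarrow>
       isomorphic G D21 \<or> isomorphic G (complement D21) \<or>
       isomorphic G C4 \<or> isomorphic G two_K2)"
  using switch_degree_one[OF assms] decomposable_switch_degree_two[OF assms]
    indecomposable_switch_degree_two[OF assms] by blast

end
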